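(* Let $X$ be a Banach lattice with the projection property. If $X^\sim_{\rm oc}$ is a norming subspace of $X^*$, then every convex Komlós set $C$ in $X$ is norm bounded.
   Context: $X$ has the projection property if every band in $X$ is a projection band. A net (in particular, a sequence) $(x_\alpha)_{\alpha\in\Gamma}$ in a vector lattice $X$ converges in order to $x\in X$ ($x_\alpha\xrightarrow{\rm o}x$) if there is a net $(a_\gamma)_{\gamma\in\Lambda}$ in $X$ (possibly over a different index set) with $a_\gamma\downarrow 0$ such that for every $\gamma\in\Lambda$ there is $\alpha_0\in\Gamma$ with $|x_\alpha-x|\le a_\gamma$ for all $\alpha\ge\alpha_0$. It uo-converges to $x$ if $|x_\alpha-x|\wedge y\xrightarrow{\rm o}0$ for every $y\in X_+$. $X^\sim_{\rm oc}$ denotes the band of all order continuous functionals in the order dual $X^\sim$ (which equals $X^*$ for a Banach lattice), i.e. those $f$ with $f(x_\alpha)\to 0$ whenever $x_\alpha\xrightarrow{\rm o}0$. A subspace $F\subseteq X^*$ is norming if $x\mapsto\sup\{|f(x)|: f\in F,\ \|f\|\le 1\}$ is a norm on $X$ equivalent to the original norm. The Cesàro means of $(x_n)$ are $\frac1n\sum_{k=1}^n x_k$. A subset $C$ of $X$ is a Komlós set if for every sequence $(x_n)$ in $C$ there are a subsequence $(x_{n_k})$ and a vector $x\in C$ such that the Cesàro means of any subsequence of $(x_{n_k})$ uo-converge to $x$ in $X$. *)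

theory Defs
  imports
    "HOL-Analysis.Analysis"
    "HOL-Library.Lattice_Algebras"
    "HOL-Library.Lub_Glb"
begin

section \<open>Banach lattices\<close>

class vector_lattice = lattice_ab_group_add_abs + ordered_real_vector

class banach_lattice = vector_lattice + banach +
  assumes norm_mono_abs: "\<bar>x\<bar> \<le> \<bar>y\<bar> \<Longrightarrow> norm x \<le> norm y"

instance real :: banach_lattice
  by standard simp


section \<open>Order convergence of nets\<close>

text \<open>A net is a family \<open>x\<close> on a carrier \<open>I\<close> that is directed by the preorder \<open>le\<close>.\<close>

definition directed_by :: "'i set \<Rightarrow> ('i \<Rightarrow> 'i \<Rightarrow> bool) \<Rightarrow> bool" where
  "directed_by I le \<longleftrightarrow>
     I \<noteq> {} \<and>
     (\<forall>i\<in>I. le i i) \<and>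
     (\<forall>i\<in>I. \<forall>j\<in>I. \<forall>k\<in>I. le i j \<longrightarrow> le j k \<longrightarrow> le i k) \<and>
     (\<forall>i\<in>I. \<forall>j\<in>I. \<exists>k\<in>I. le i k \<and> le j k)"

definition decreases_to ::
    "'j set \<Rightarrow> ('j \<Rightarrow> 'j \<Rightarrow> bool) \<Rightarrow> ('j \<Rightarrow> 'a::order) \<Rightarrow> 'a \<Rightarrow> bool" where
  "decreases_to J le a l \<longleftrightarrow>
     directed_by J le \<and> (\<forall>i\<in>J. \<forall>j\<in>J. le i j \<longrightarrow> a j \<le> a i) \<and> isGlb UNIV (a ` J) l"

text \<open>The index set of the dominating net is taken inside \<open>'a\<close>, since HOL cannot quantify over
  types inside a formula. By \<open>order_conv_iff_dominated\<close> below, index sets of any type containing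
  a copy of \<open>'a\<close> give the same notion, and by \<open>order_convI\<close> no other type gives more.\<close>

definition order_conv ::
    "'i set \<Rightarrow> ('i \<Rightarrow> 'i \<Rightarrow> bool) \<Rightarrow> ('i \<Rightarrow> 'a::vector_lattice) \<Rightarrow> 'a \<Rightarrow> bool" where
  "order_conv I le x l \<longleftrightarrow>
     (\<exists>(J :: 'a set) leJ a. decreases_to J leJ a 0 \<and>
        (\<forall>j\<in>J. \<exists>i0\<in>I. \<forall>i\<in>I. le i0 i \<longrightarrow> \<bar>x i - l\<bar> \<le> a j))"

definition uo_conv ::
    "'i set \<Rightarrow> ('i \<Rightarrow> 'i \<Rightarrow> bool) \<Rightarrow> ('i \<Rightarrow> 'a::vector_lattice) \<Rightarrow> 'a \<Rightarrow> bool" where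
  "uo_conv I le x l \<longleftrightarrow> (\<forall>y\<ge>0. order_conv I le (\<lambda>i. inf \<bar>x i - l\<bar> y) 0)"

lemma order_convI:
  fixes a :: "'j \<Rightarrow> 'a::vector_lattice"
  assumes a: "decreases_to J leJ a 0"
    and dom: "\<forall>j\<in>J. \<exists>i0\<in>I. \<forall>i\<in>I. le i0 i \<longrightarrow> \<bar>x i - l\<bar> \<le> a j"
  shows "order_conv I le x l"
proof -
  have dir: "directed_by J leJ"
    and mono: "\<And>i j. i \<in> J \<Longrightarrow> j \<in> J \<Longrightarrow> leJ i j \<Longrightarrow> a j \<le> a i"
    and glb: "isGlb UNIV (a ` J) 0"
    using a by (auto simp: decreases_to_def)
  have "\<exists>w\<in>a ` J. w \<le> u \<and> w \<le> v" if uv: "u \<in> a ` J" "v \<in> a ` J" for u v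
  proof -
    from uv obtain i j where ij: "i \<in> J" "j \<in> J" "u = a i" "v = a j" by blast
    with dir obtain k where "k \<in> J" "leJ i k" "leJ j k" unfolding directed_by_def by blast
    with ij mono show ?thesis by blast
  qed
  moreover have "a ` J \<noteq> {}" using dir by (simp add: directed_by_def)
  ultimately have "directed_by (a ` J) (\<ge>)"
    unfolding directed_by_def by (meson order_refl order_trans)
  then have "decreases_to (a ` J) (\<ge>) id 0"
    using glb by (simp add: decreases_to_def)
  moreover have "\<forall>u\<in>a ` J. \<exists>i0\<in>I. \<forall>i\<in>I. le i0 i \<longrightarrow> \<bar>x i - l\<bar> \<le> id u"
    using dom by simp
  ultimately show ?thesis unfolding order_conv_def by blast
qed

lemma order_conv_iff_dominated:
  fixes x :: "'i \<Rightarrow> 'a::vector_lattice" and \<iota> :: "'a \<Rightarrow> 'j"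
  assumes "inj \<iota>"
  shows "order_conv I le x l \<longleftrightarrow>
    (\<exists>(J :: 'j set) leJ a. decreases_to J leJ a 0 \<and>
        (\<forall>j\<in>J. \<exists>i0\<in>I. \<forall>i\<in>I. le i0 i \<longrightarrow> \<bar>x i - l\<bar> \<le> a j))" (is "_ \<longleftrightarrow> ?R")
proof
  assume "order_conv I le x l"
  then obtain J :: "'a set" and leJ a where a: "decreases_to J leJ a 0"
    and dom: "\<forall>j\<in>J. \<exists>i0\<in>I. \<forall>i\<in>I. le i0 i \<longrightarrow> \<bar>x i - l\<bar> \<le> a j"
    unfolding order_conv_def by blast
  let ?v = "inv \<iota>"
  have v: "?v (\<iota> u) = u" for u using assms by simp
  have "decreases_to (\<iota> ` J) (\<lambda>i j. leJ (?v i) (?v j)) (\<lambda>i. a (?v i)) 0 \<longleftrightarrow>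
      decreases_to J leJ a 0"
    by (simp only: decreases_to_def directed_by_def ball_simps bex_simps image_image
        image_is_empty v)
  with a have "decreases_to (\<iota> ` J) (\<lambda>i j. leJ (?v i) (?v j)) (\<lambda>i. a (?v i)) 0"
    by blast
  moreover have "\<forall>j\<in>\<iota> ` J. \<exists>i0\<in>I. \<forall>i\<in>I. le i0 i \<longrightarrow> \<bar>x i - l\<bar> \<le> a (?v j)"
    using dom by (simp add: v)
  ultimately show ?R by blast
qed (blast intro: order_convI)


section \<open>Order continuous functionals\<close>

definition net_tendsto_real :: "'i set \<Rightarrow> ('i \<Rightarrow> 'i \<Rightarrow> bool) \<Rightarrow> ('i \<Rightarrow> real) \<Rightarrow> real \<Rightarrow> bool" where
  "net_tendsto_real I le y l \<longleftrightarrow> (\<forall>e>0. \<exists>i0\<in>I. \<forall>i\<in>I. le i0 i \<longrightarrow> \<bar>y i - l\<bar> < e)"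

text \<open>The index type \<open>'a \<times> 'a set\<close> is large enough to test all nets in \<open>'a\<close>: a net may be
  re-indexed by the pairs of one of its values and a tail containing that value, see
  \<open>order_continuousD\<close>.\<close>

definition order_continuous :: "('a::vector_lattice \<Rightarrow> real) \<Rightarrow> bool" where
  "order_continuous f \<longleftrightarrow>
     (\<forall>(I :: ('a \<times> 'a set) set) le x. directed_by I le \<longrightarrow> order_conv I le x 0 \<longrightarrow>
        net_tendsto_real I le (\<lambda>i. f (x i)) 0)"

lemma order_continuousD:
  fixes x :: "'i \<Rightarrow> 'a::vector_lattice"
  assumes f: "order_continuous f" and dir: "directed_by I le" and conv: "order_conv I le x 0"
  shows "net_tendsto_real I le (\<lambda>i. f (x i)) 0"
proof -
  define T where "T k = x ` {i\<in>I. le k i}" for k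
  define K where "K = {(x i, T k) | i k. i \<in> I \<and> k \<in> I \<and> le k i}"
  define leK :: "'a \<times> 'a set \<Rightarrow> 'a \<times> 'a set \<Rightarrow> bool" where "leK p q \<longleftrightarrow> snd q \<subseteq> snd p" for p q
  have refl: "\<And>i. i \<in> I \<Longrightarrow> le i i"
    and tr: "\<And>i j k. i \<in> I \<Longrightarrow> j \<in> I \<Longrightarrow> k \<in> I \<Longrightarrow> le i j \<Longrightarrow> le j k \<Longrightarrow> le i k"
    and ub: "\<And>i j. i \<in> I \<Longrightarrow> j \<in> I \<Longrightarrow> \<exists>k\<in>I. le i k \<and> le j k"
    and ne: "I \<noteq> {}"
    using dir unfolding directed_by_def by blast+
  have K: "(x i, T i) \<in> K" if "i \<in> I" for i using that refl unfolding K_def by blast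
  have T_mono: "T j \<subseteq> T i" if "i \<in> I" "j \<in> I" "le i j" for i j
    using that tr unfolding T_def by blast
  have K_ub: "\<exists>r\<in>K. leK p r \<and> leK q r" if pq: "p \<in> K" "q \<in> K" for p q
  proof -
    from pq obtain i j where ij: "i \<in> I" "j \<in> I" "snd p = T i" "snd q = T j"
      unfolding K_def by auto
    with ub obtain k where k: "k \<in> I" "le i k" "le j k" by blast
    with ij K[of k] T_mono show ?thesis unfolding leK_def by (metis snd_conv)
  qed
  have dirK: "directed_by K leK"
    unfolding directed_by_def
  proof (intro conjI)
    show "K \<noteq> {}" using ne K by blast
  qed (use K_ub in \<open>auto simp: leK_def\<close>)
  have above: "\<exists>i\<in>I. le k i \<and> fst p = x i" if "p \<in> K" "leK (x k, T k) p" for p k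
  proof -
    from that have "fst p \<in> snd p" unfolding K_def T_def by auto
    with that(2) show ?thesis unfolding leK_def T_def by auto
  qed
  have "order_conv K leK fst 0"
  proof -
    obtain J :: "'a set" and leJ a where a: "decreases_to J leJ a 0"
      and dom: "\<forall>j\<in>J. \<exists>i0\<in>I. \<forall>i\<in>I. le i0 i \<longrightarrow> \<bar>x i - 0\<bar> \<le> a j"
      using conv unfolding order_conv_def by blast
    have "\<exists>p0\<in>K. \<forall>p\<in>K. leK p0 p \<longrightarrow> \<bar>fst p - 0\<bar> \<le> a j" if "j \<in> J" for j
    proof -
      from dom that obtain i0 where "i0 \<in> I" "\<forall>i\<in>I. le i0 i \<longrightarrow> \<bar>x i - 0\<bar> \<le> a j" by blast
      with K[of i0] above show ?thesis by metis
    qed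
    with a show ?thesis by (intro order_convI) blast+
  qed
  with f dirK have lim: "net_tendsto_real K leK (\<lambda>p. f (fst p)) 0"
    unfolding order_continuous_def by blast
  show ?thesis
    unfolding net_tendsto_real_def
  proof (intro allI impI)
    fix e :: real assume "e > 0"
    with lim obtain p0 where p0: "p0 \<in> K" "\<forall>p\<in>K. leK p0 p \<longrightarrow> \<bar>f (fst p) - 0\<bar> < e"
      unfolding net_tendsto_real_def by blast
    then obtain k where k: "k \<in> I" "snd p0 = T k" unfolding K_def by auto
    have "\<bar>f (x i) - 0\<bar> < e" if "i \<in> I" "le k i" for i
    proof -
      have "(x i, T k) \<in> K" using that k unfolding K_def by blast
      with p0 k show ?thesis unfolding leK_def by force
    qed
    with k show "\<exists>i0\<in>I. \<forall>i\<in>I. le i0 i \<longrightarrow> \<bar>f (x i) - 0\<bar> < e" by blast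
  qed
qed

text \<open>The order dual of a Banach lattice is its norm dual, here \<open>'a \<Rightarrow>\<^sub>L real\<close> with the
  operator norm.\<close>

definition oc_dual :: "('a::banach_lattice \<Rightarrow>\<^sub>L real) set" where
  "oc_dual = {f. order_continuous (blinfun_apply f)}"

lemma oc_dualD:
  assumes "f \<in> oc_dual" "directed_by I le" "order_conv I le x 0" "e > 0"
  shows "\<exists>i0\<in>I. \<forall>i\<in>I. le i0 i \<longrightarrow> \<bar>blinfun_apply f (x i) - 0\<bar> < e"
  using assms order_continuousD[of "blinfun_apply f" I le x]
  unfolding oc_dual_def net_tendsto_real_def by blast

lemma subspace_oc_dual: "subspace (oc_dual :: ('a::banach_lattice \<Rightarrow>\<^sub>L real) set)"
proof (rule subspaceI)
  have "net_tendsto_real I le (\<lambda>i. blinfun_apply (0 :: 'a \<Rightarrow>\<^sub>L real) (x i)) 0"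
    if "directed_by I le" for I :: "('a \<times> 'a set) set" and le x
  proof -
    from that obtain i where "i \<in> I" unfolding directed_by_def by blast
    then show ?thesis unfolding net_tendsto_real_def by (metis abs_zero diff_self zero_blinfun.rep_eq)
  qed
  then show "(0 :: 'a \<Rightarrow>\<^sub>L real) \<in> oc_dual"
    unfolding oc_dual_def order_continuous_def by blast
next
  fix f g :: "'a \<Rightarrow>\<^sub>L real"
  assume fg: "f \<in> oc_dual" "g \<in> oc_dual"
  show "f + g \<in> oc_dual"
    unfolding oc_dual_def order_continuous_def net_tendsto_real_def mem_Collect_eq
  proof (intro allI impI)
    fix I :: "('a \<times> 'a set) set" and le and x :: "'a \<times> 'a set \<Rightarrow> 'a" and e :: real
    assume dir: "directed_by I le" and conv: "order_conv I le x 0" and "e > 0"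
    then have "e / 2 > 0" by simp
    obtain i where i: "i \<in> I" "\<forall>k\<in>I. le i k \<longrightarrow> \<bar>blinfun_apply f (x k) - 0\<bar> < e / 2"
      using oc_dualD[OF fg(1) dir conv \<open>e / 2 > 0\<close>] by blast
    obtain j where j: "j \<in> I" "\<forall>k\<in>I. le j k \<longrightarrow> \<bar>blinfun_apply g (x k) - 0\<bar> < e / 2"
      using oc_dualD[OF fg(2) dir conv \<open>e / 2 > 0\<close>] by blast
    obtain k where k: "k \<in> I" "le i k" "le j k"
      using dir i j unfolding directed_by_def by blast
    have "\<bar>blinfun_apply (f + g) (x m) - 0\<bar> < e" if m: "m \<in> I" "le k m" for m
    proof -
      have "le i m" "le j m" using dir i j k m unfolding directed_by_def by blast+
      then have "\<bar>blinfun_apply f (x m) - 0\<bar> < e / 2" "\<bar>blinfun_apply g (x m) - 0\<bar> < e / 2"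
        using i j m by auto
      then show ?thesis by (simp add: blinfun.add_left)
    qed
    with k show "\<exists>i0\<in>I. \<forall>i\<in>I. le i0 i \<longrightarrow> \<bar>blinfun_apply (f + g) (x i) - 0\<bar> < e" by blast
  qed
next
  fix c :: real and f :: "'a \<Rightarrow>\<^sub>L real"
  assume f: "f \<in> oc_dual"
  show "c *\<^sub>R f \<in> oc_dual"
    unfolding oc_dual_def order_continuous_def net_tendsto_real_def mem_Collect_eq
  proof (intro allI impI)
    fix I :: "('a \<times> 'a set) set" and le and x :: "'a \<times> 'a set \<Rightarrow> 'a" and e :: real
    assume dir: "directed_by I le" and conv: "order_conv I le x 0" and e: "e > 0"
    have pos: "e / (\<bar>c\<bar> + 1) > 0" using e by (intro divide_pos_pos) auto
    obtain i where i: "i \<in> I"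
        "\<forall>k\<in>I. le i k \<longrightarrow> \<bar>blinfun_apply f (x k) - 0\<bar> < e / (\<bar>c\<bar> + 1)"
      using oc_dualD[OF f dir conv pos] by blast
    have "\<bar>blinfun_apply (c *\<^sub>R f) (x k) - 0\<bar> < e" if "k \<in> I" "le i k" for k
    proof -
      have *: "\<bar>blinfun_apply f (x k)\<bar> * (\<bar>c\<bar> + 1) < e"
        using i(2) that by (simp add: pos_less_divide_eq)
      have "\<bar>blinfun_apply (c *\<^sub>R f) (x k) - 0\<bar> = \<bar>blinfun_apply f (x k)\<bar> * \<bar>c\<bar>"
        by (simp add: blinfun.scaleR_left abs_mult)
      also have "\<dots> \<le> \<bar>blinfun_apply f (x k)\<bar> * (\<bar>c\<bar> + 1)"
        by (simp add: mult_left_mono)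
      finally show ?thesis using * by simp
    qed
    with i show "\<exists>i0\<in>I. \<forall>k\<in>I. le i0 k \<longrightarrow> \<bar>blinfun_apply (c *\<^sub>R f) (x k) - 0\<bar> < e" by blast
  qed
qed


section \<open>Norming subspaces\<close>

definition is_norm :: "('a::real_vector \<Rightarrow> real) \<Rightarrow> bool" where
  "is_norm p \<longleftrightarrow>
     (\<forall>x. p x \<ge> 0) \<and> (\<forall>x. p x = 0 \<longleftrightarrow> x = 0) \<and>
     (\<forall>x y. p (x + y) \<le> p x + p y) \<and> (\<forall>c x. p (c *\<^sub>R x) = \<bar>c\<bar> * p x)"

definition equivalent_norms :: "('a::real_vector \<Rightarrow> real) \<Rightarrow> ('a \<Rightarrow> real) \<Rightarrow> bool" where
  "equivalent_norms p q \<longleftrightarrow> (\<exists>c>0. \<exists>d>0. \<forall>x. c * q x \<le> p x \<and> p x \<le> d * q x)"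

definition norming :: "('a::real_normed_vector \<Rightarrow>\<^sub>L real) set \<Rightarrow> bool" where
  "norming F \<longleftrightarrow> subspace F \<and>
     (let p = (\<lambda>x. SUP f\<in>{f\<in>F. norm f \<le> 1}. \<bar>blinfun_apply f x\<bar>)
      in is_norm p \<and> equivalent_norms p norm)"


section \<open>Bands\<close>

definition order_ideal :: "'a::vector_lattice set \<Rightarrow> bool" where
  "order_ideal B \<longleftrightarrow> subspace B \<and> (\<forall>x y. y \<in> B \<longrightarrow> \<bar>x\<bar> \<le> \<bar>y\<bar> \<longrightarrow> x \<in> B)"

definition band :: "'a::vector_lattice set \<Rightarrow> bool" where
  "band B \<longleftrightarrow> order_ideal B \<and> (\<forall>D s. D \<subseteq> B \<longrightarrow> isLub UNIV D s \<longrightarrow> s \<in> B)"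

definition disjoint_complement :: "'a::vector_lattice set \<Rightarrow> 'a set" where
  "disjoint_complement B = {x. \<forall>b\<in>B. inf \<bar>x\<bar> \<bar>b\<bar> = 0}"

text \<open>The sum of \<open>B\<close> and its disjoint complement is automatically direct.\<close>

definition projection_band :: "'a::vector_lattice set \<Rightarrow> bool" where
  "projection_band B \<longleftrightarrow>
     band B \<and> (\<forall>x. \<exists>b\<in>B. \<exists>c\<in>disjoint_complement B. x = b + c)"

definition projection_property :: "'a::vector_lattice itself \<Rightarrow> bool" where
  "projection_property _ \<longleftrightarrow> (\<forall>B::'a set. band B \<longrightarrow> projection_band B)"


section \<open>Komlos sets\<close>

text \<open>Sequences are indexed from 0, so \<open>cesaro x n\<close> is the mean of the first \<open>n + 1\<close> terms.\<close>

definition cesaro :: "(nat \<Rightarrow> 'a::real_vector) \<Rightarrow> nat \<Rightarrow> 'a" where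
  "cesaro x n = (1 / real (Suc n)) *\<^sub>R (\<Sum>k\<le>n. x k)"

definition komlos_set :: "'a::vector_lattice set \<Rightarrow> bool" where
  "komlos_set C \<longleftrightarrow>
     (\<forall>x :: nat \<Rightarrow> 'a. range x \<subseteq> C \<longrightarrow>
        (\<exists>r v. strict_mono (r :: nat \<Rightarrow> nat) \<and> v \<in> C \<and>
           (\<forall>s :: nat \<Rightarrow> nat. strict_mono s \<longrightarrow> uo_conv UNIV (\<le>) (cesaro (x \<circ> r \<circ> s)) v)))"

end

theory Submission
  imports Defs
begin

text \<open>
  For \<open>f\<close> in the order continuous dual, \<open>q x = \<bar>f\<bar> \<bar>x\<bar>\<close> is an order continuous lattice seminorm.
  Komlos sets are bounded for the truncations \<open>q (inf \<bar>x\<bar> u)\<close>, since \<open>x n / n\<close> is uo-null along a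
  subsequence of any sequence in \<open>C\<close>. If \<open>q\<close> were unbounded on the convex set \<open>C\<close>, a gliding hump
  would give \<open>y n \<in> C\<close> with \<open>q (y n) \<ge> n\<close> whose increments are summable after truncation by earlier
  terms. The Cesaro limit \<open>v\<close> of a subsequence then satisfies \<open>n \<le> q v + 1\<close> for all \<open>n\<close>, which is
  absurd. So every \<open>f\<close> in the order continuous dual is bounded on \<open>C\<close>, and as this dual is norm
  closed and norming, the uniform boundedness principle applies.
\<close>

section \<open>Inequalities in lattice-ordered groups and vector lattices\<close>

text \<open>Distributing \<open>+\<close> over \<open>inf\<close> turns the right-hand side into the
  meet of \<open>a + b\<close>, \<open>a + u\<close>, \<open>u + b\<close> and \<open>u + u\<close>,
  each an upper bound of the left-hand side.\<close>

lemma inf_add_le_add_inf: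
  fixes a b u :: "'a::lattice_ab_group_add"
  assumes "0 \<le> a" "0 \<le> b" "0 \<le> u"
  shows "inf (a + b) u \<le> inf a u + inf b u"
proof -
  have "inf (a + b) u \<le> a + b" by simp
  moreover have "inf (a + b) u \<le> a + u"
    using assms by (meson add_increasing inf.coboundedI2 order_refl)
  moreover have "inf (a + b) u \<le> u + b"
    using assms by (meson add_increasing2 inf.coboundedI2 order_refl)
  moreover have "inf (a + b) u \<le> u + u"
    using assms by (meson add_increasing2 inf.coboundedI2 order_refl)
  ultimately show ?thesis
    by (simp add: add_inf_distrib_left add_inf_distrib_right)
qed

text \<open>Riesz decomposition: \<open>y1\<close> is \<open>y\<close> clipped to the interval from
  \<open>- a\<close> to \<open>a\<close>, and what is clipped off cannot exceed \<open>b\<close> in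
  modulus.\<close>

lemma abs_le_add_decompose:
  fixes y a b :: "'a::lattice_ab_group_add_abs"
  assumes "\<bar>y\<bar> \<le> a + b" "0 \<le> a" "0 \<le> b"
  obtains y1 y2 where "y = y1 + y2" "\<bar>y1\<bar> \<le> a" "\<bar>y2\<bar> \<le> b"
proof
  let ?y1 = "inf a (sup (- a) y)"
  have y: "y \<le> b + a" "- y \<le> b + a"
    using assms(1) by (auto simp: add.commute intro: order_trans[OF abs_ge_self] order_trans[OF abs_ge_minus_self])
  show "y = ?y1 + (y - ?y1)" by (simp only: add_diff_eq add_diff_cancel_left')
  have "- a \<le> a"
    using assms(2) by (meson neg_le_0_iff_le order_trans)
  then have "- a \<le> ?y1" by simp
  then have "- ?y1 \<le> a" using minus_le_iff by blast
  then show "\<bar>?y1\<bar> \<le> a" by (intro abs_leI) simp_all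
  have "y \<le> b + ?y1"
    using y(1) assms(3) by (auto simp: add_inf_distrib_left intro: le_supI2 order_trans[OF _ add_left_mono[OF sup_ge2]])
  moreover have "?y1 \<le> b + y"
  proof -
    have "- a \<le> b + y" using add_right_mono[OF y(2), of "y - a"] by (simp add: algebra_simps)
    then have "sup (- a) y \<le> b + y" using assms(3) by simp
    then show ?thesis by (rule le_infI2)
  qed
  ultimately show "\<bar>y - ?y1\<bar> \<le> b"
    by (intro abs_leI) (simp_all only: minus_diff_eq diff_le_eq)
qed

lemma abs_scaleR_le:
  fixes x :: "'a::vector_lattice"
  assumes "0 \<le> c"
  shows "\<bar>c *\<^sub>R x\<bar> \<le> c *\<^sub>R \<bar>x\<bar>"
proof (rule abs_leI)
  show "c *\<^sub>R x \<le> c *\<^sub>R \<bar>x\<bar>"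
    by (intro scaleR_left_mono abs_ge_self assms)
  have "c *\<^sub>R - x \<le> c *\<^sub>R \<bar>x\<bar>"
    by (intro scaleR_left_mono abs_ge_minus_self assms)
  then show "- (c *\<^sub>R x) \<le> c *\<^sub>R \<bar>x\<bar>" by simp
qed

text \<open>The reverse inequality is \<open>abs_scaleR_le\<close> for \<open>inverse c\<close>
  applied to \<open>c *\<^sub>R x\<close>.\<close>

lemma abs_scaleR_nonneg:
  fixes x :: "'a::vector_lattice"
  assumes "0 \<le> c"
  shows "\<bar>c *\<^sub>R x\<bar> = c *\<^sub>R \<bar>x\<bar>"
proof (cases "c = 0")
  case False
  with assms have c: "0 < c" by simp
  have "\<bar>x\<bar> = \<bar>inverse c *\<^sub>R c *\<^sub>R x\<bar>" using c by simp
  also have "\<dots> \<le> inverse c *\<^sub>R \<bar>c *\<^sub>R x\<bar>" using c by (intro abs_scaleR_le) simp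
  finally have "c *\<^sub>R \<bar>x\<bar> \<le> c *\<^sub>R inverse c *\<^sub>R \<bar>c *\<^sub>R x\<bar>"
    using c by (intro scaleR_left_mono) auto
  with c abs_scaleR_le[OF assms, of x] show ?thesis by simp
qed simp

lemma abs_sum_le:
  fixes g :: "'i \<Rightarrow> 'a::lattice_ab_group_add_abs"
  shows "\<bar>sum g A\<bar> \<le> (\<Sum>i\<in>A. \<bar>g i\<bar>)"
proof (induction A rule: infinite_finite_induct)
  case (insert i A)
  then show ?case
    by (simp add: order_trans[OF abs_triangle_ineq])
qed simp_all

text \<open>Distributivity reduces this to the triangle inequality. As the truncation level is
  \<open>\<bar>x\<bar>\<close> itself, a bound on the truncated distance to \<open>v\<close>
  controls all of \<open>x\<close>.\<close>

lemma abs_le_add_inf_diff: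
  fixes x v :: "'a::lattice_ab_group_add_abs"
  shows "\<bar>x\<bar> \<le> \<bar>v\<bar> + inf \<bar>v - x\<bar> \<bar>x\<bar>"
proof -
  have "\<bar>x\<bar> \<le> \<bar>v\<bar> + \<bar>v - x\<bar>"
    using abs_triangle_ineq4[of v "v - x"] by simp
  then show ?thesis
    by (simp add: add_inf_distrib_left)
qed

lemma komlos_setE:
  assumes "komlos_set C" "\<And>n. x n \<in> C"
  obtains r v where "strict_mono (r :: nat \<Rightarrow> nat)" "uo_conv UNIV (\<le>) (cesaro (x \<circ> r)) v"
proof -
  from assms(2) have "range x \<subseteq> C" by blast
  with assms(1) obtain r :: "nat \<Rightarrow> nat" and v where r: "strict_mono r"
    and "\<forall>s. strict_mono s \<longrightarrow> uo_conv UNIV (\<le>) (cesaro (x \<circ> r \<circ> s)) v"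
    unfolding komlos_set_def by blast
  then have "uo_conv UNIV (\<le>) (cesaro (x \<circ> r \<circ> id)) v"
    using strict_mono_id by blast
  with r show thesis by (intro that) simp_all
qed


section \<open>Order continuous lattice seminorms\<close>

text \<open>Order continuity is asked along sequences because it is applied to Cesaro means.
  Homogeneity for nonnegative scalars is enough since \<open>mono\<close> makes \<open>q\<close>
  insensitive to signs.\<close>

locale order_continuous_seminorm =
  fixes q :: "'a::vector_lattice \<Rightarrow> real"
  assumes mono: "\<bar>x\<bar> \<le> \<bar>y\<bar> \<Longrightarrow> q x \<le> q y"
    and triangle: "q (x + y) \<le> q x + q y"
    and scale: "0 \<le> c \<Longrightarrow> q (c *\<^sub>R x) = c * q x"
    and order_cont: "order_conv UNIV (\<le>) (X :: nat \<Rightarrow> 'a) 0 \<Longrightarrow> (\<lambda>n. q (X n)) \<longlonglongrightarrow> 0"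
begin

lemma zero [simp]: "q 0 = 0"
  using scale[of 0 0] by simp

lemma nonneg: "0 \<le> q x"
  using mono[of 0 x] by simp

lemma mono_nonneg: "0 \<le> x \<Longrightarrow> x \<le> y \<Longrightarrow> q x \<le> q y"
  using mono[of x y] by (metis abs_of_nonneg order_trans)

lemma abs_eq [simp]: "q \<bar>x\<bar> = q x"
  by (intro antisym mono) auto

lemma minus_eq: "q (- x) = q x"
  by (intro antisym mono) auto

section \<open>Calculus of the truncations \<open>q (inf a u)\<close>\<close>

lemma truncated_add:
  assumes "0 \<le> a" "0 \<le> b" "0 \<le> u"
  shows "q (inf (a + b) u) \<le> q (inf a u) + q (inf b u)"
  using assms by (intro order_trans[OF mono_nonneg[OF _ inf_add_le_add_inf] triangle]) auto

lemma truncated_sum: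
  assumes "\<And>i. i \<in> A \<Longrightarrow> 0 \<le> g i" "0 \<le> u"
  shows "q (inf (sum g A) u) \<le> (\<Sum>i\<in>A. q (inf (g i) u))"
  using assms
proof (induction A rule: infinite_finite_induct)
  case (insert i A)
  then have "q (inf (g i + sum g A) u) \<le> q (inf (g i) u) + q (inf (sum g A) u)"
    by (intro truncated_add sum_nonneg) auto
  with insert show ?case by fastforce
qed (simp_all add: inf_absorb1)

lemma truncated_mono:
  assumes "0 \<le> a" "a \<le> b" "0 \<le> u" "u \<le> w"
  shows "q (inf a u) \<le> q (inf b w)"
  using assms by (intro mono_nonneg inf_mono) auto

lemma truncated_le: "0 \<le> a \<Longrightarrow> 0 \<le> u \<Longrightarrow> q (inf a u) \<le> q a"
  by (intro mono_nonneg) auto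

section \<open>Smallness of truncations from uo-convergent Cesaro means\<close>

lemma uo_conv_truncated:
  assumes "uo_conv UNIV (\<le>) (X :: nat \<Rightarrow> 'a) l" "0 \<le> u"
  shows "(\<lambda>n. q (inf \<bar>X n - l\<bar> u)) \<longlonglongrightarrow> 0"
  using assms unfolding uo_conv_def by (intro order_cont) blast

text \<open>If \<open>c n\<close> are the means of \<open>z\<close>, then \<open>z (n + 1) / (n + 2)\<close> is a difference of two terms with
  the same uo-limit, hence uo-null.\<close>

lemma cesaro_uo_conv_imp_terms_small:
  assumes conv: "uo_conv UNIV (\<le>) (cesaro z) v" and u: "0 \<le> u"
  shows "(\<lambda>n. q (inf ((1 / real (Suc (Suc n))) *\<^sub>R \<bar>z (Suc n)\<bar>) u)) \<longlonglongrightarrow> 0"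
proof -
  let ?c = "cesaro z" and ?t = "\<lambda>n. 1 / real (Suc (Suc n))"
  let ?d = "\<lambda>n. q (inf \<bar>?c n - v\<bar> u)"
  have *: "q (inf (?t n *\<^sub>R \<bar>z (Suc n)\<bar>) u) \<le> ?d (Suc n) + ?d n + ?t n * q v" for n
  proof -
    define t where "t = ?t n"
    define s where "s = real (Suc n) / real (Suc (Suc n))"
    have s: "0 \<le> s" "s \<le> 1" "s = 1 - t" and t: "0 \<le> t"
      by (auto simp: field_simps s_def t_def)
    have "t *\<^sub>R z (Suc n) = ?c (Suc n) - s *\<^sub>R ?c n"
      by (simp add: cesaro_def scaleR_add_right s_def t_def)
    \<comment> \<open>As \<open>s = 1 - t\<close>, centring both means at \<open>v\<close> leaves
      only the correction \<open>t *\<^sub>R v\<close>, which vanishes with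
      \<open>t\<close>.\<close>
    also have "\<dots> = (?c (Suc n) - v) + (t *\<^sub>R v - s *\<^sub>R (?c n - v))"
      unfolding s(3) by (simp add: scaleR_diff_right scaleR_diff_left)
    also have "\<bar>\<dots>\<bar> \<le> \<bar>?c (Suc n) - v\<bar> + \<bar>t *\<^sub>R v - s *\<^sub>R (?c n - v)\<bar>"
      by (rule abs_triangle_ineq)
    also have "\<dots> \<le> \<bar>?c (Suc n) - v\<bar> + (\<bar>t *\<^sub>R v\<bar> + \<bar>s *\<^sub>R (?c n - v)\<bar>)"
      by (intro add_left_mono abs_triangle_ineq4)
    also have "\<dots> \<le> \<bar>?c (Suc n) - v\<bar> + (t *\<^sub>R \<bar>v\<bar> + \<bar>?c n - v\<bar>)"
      using s(1,2) t scaleR_right_mono[of s 1 "\<bar>?c n - v\<bar>"] by (simp add: abs_scaleR_nonneg)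
    finally have le: "?t n *\<^sub>R \<bar>z (Suc n)\<bar> \<le> \<bar>?c (Suc n) - v\<bar> + (\<bar>?c n - v\<bar> + ?t n *\<^sub>R \<bar>v\<bar>)"
      using t by (simp only: abs_scaleR_nonneg t_def add.commute)
    have tv: "0 \<le> ?t n *\<^sub>R \<bar>v\<bar>" by (intro scaleR_nonneg_nonneg) auto
    have "q (inf (?t n *\<^sub>R \<bar>z (Suc n)\<bar>) u) \<le>
        q (inf (\<bar>?c (Suc n) - v\<bar> + (\<bar>?c n - v\<bar> + ?t n *\<^sub>R \<bar>v\<bar>)) u)"
      using u le by (intro truncated_mono scaleR_nonneg_nonneg) auto
    also have "\<dots> \<le> ?d (Suc n) + (?d n + q (inf (?t n *\<^sub>R \<bar>v\<bar>) u))"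
      using u tv by (intro order_trans[OF truncated_add] add_left_mono truncated_add add_nonneg_nonneg) auto
    also have "q (inf (?t n *\<^sub>R \<bar>v\<bar>) u) \<le> ?t n * q v"
      using truncated_le[OF tv u] by (simp add: scale)
    finally show ?thesis by simp
  qed
  have d: "?d \<longlonglongrightarrow> 0" by (rule uo_conv_truncated[OF conv u])
  have t: "?t \<longlonglongrightarrow> 0"
    using LIMSEQ_Suc[OF LIMSEQ_Suc[OF lim_1_over_n]] by simp
  have lim: "(\<lambda>n. ?d (Suc n) + ?d n + ?t n * q v) \<longlonglongrightarrow> 0"
    using tendsto_add[OF tendsto_add[OF LIMSEQ_Suc[OF d] d] tendsto_mult_left_zero[OF t]] by simp
  show ?thesis
    by (rule real_tendsto_sandwich[OF always_eventually always_eventually tendsto_const lim])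
      (intro allI nonneg *)+
qed

text \<open>This is boundedness in measure for the topology given by the truncations \<open>q (inf \<bar>x\<bar> u)\<close>.\<close>

lemma komlos_set_uniformly_absorbed:
  assumes C: "komlos_set C" and u: "0 \<le> u" and e: "0 < e"
  obtains t where "0 < t" "t \<le> 1" "\<And>x. x \<in> C \<Longrightarrow> q (inf (t *\<^sub>R \<bar>x\<bar>) u) \<le> e"
proof -
  have "\<exists>n. \<forall>x\<in>C. q (inf ((1 / real (Suc n)) *\<^sub>R \<bar>x\<bar>) u) \<le> e"
  proof (rule ccontr)
    assume "\<not> ?thesis"
    then obtain x where x: "\<And>n. x n \<in> C" "\<And>n. e < q (inf ((1 / real (Suc n)) *\<^sub>R \<bar>x n\<bar>) u)"
      by (metis not_le)
    from C x(1) obtain r v where r: "strict_mono r" "uo_conv UNIV (\<le>) (cesaro (x \<circ> r)) v"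
      by (rule komlos_setE)
    from LIMSEQ_D[OF cesaro_uo_conv_imp_terms_small[OF r(2) u] e]
    obtain n where "q (inf ((1 / real (Suc (Suc n))) *\<^sub>R \<bar>x (r (Suc n))\<bar>) u) < e"
      by (auto simp: abs_less_iff)
    \<comment> \<open>The counterexample \<open>x (r (Suc n))\<close> was chosen for the weight of
      its own index. Since \<open>r (Suc n)\<close> is at least \<open>Suc n\<close>, that weight is
      at most the one in the Cesaro estimate.\<close>
    moreover have "q (inf ((1 / real (Suc (r (Suc n)))) *\<^sub>R \<bar>x (r (Suc n))\<bar>) u) \<le>
        q (inf ((1 / real (Suc (Suc n))) *\<^sub>R \<bar>x (r (Suc n))\<bar>) u)"
      using u seq_suble[OF r(1), of "Suc n"]
      by (intro truncated_mono scaleR_right_mono scaleR_nonneg_nonneg divide_left_mono) auto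
    ultimately show False using x(2)[of "r (Suc n)"] by simp
  qed
  then obtain n where n: "\<forall>x\<in>C. q (inf ((1 / real (Suc n)) *\<^sub>R \<bar>x\<bar>) u) \<le> e" by blast
  show ?thesis by (rule that[of "1 / real (Suc n)"]) (use n in auto)
qed

section \<open>Gliding hump in an unbounded convex Komlos set\<close>

text \<open>Move from \<open>y\<close> by a small proportion \<open>t\<close> towards a point of
  \<open>C\<close> with huge \<open>q\<close>. Since \<open>t\<close> works for all of
  \<open>C\<close>, it can be fixed before that point, and the move stays small after
  truncation.\<close>

lemma gliding_hump_step:
  assumes C: "komlos_set C" "convex C" and unbdd: "\<And>K. \<exists>x\<in>C. K \<le> q x"
    and y: "y \<in> C" and u: "0 \<le> u" and e: "0 < e"
  obtains y' where "y' \<in> C" "K \<le> q y'" "q (inf \<bar>y' - y\<bar> u) \<le> e"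
proof -
  obtain t where t: "0 < t" "t \<le> 1" and small: "\<And>x. x \<in> C \<Longrightarrow> q (inf (t *\<^sub>R \<bar>x\<bar>) u) \<le> e / 2"
    using komlos_set_uniformly_absorbed[OF C(1) u, of "e / 2"] e by (metis half_gt_zero)
  \<comment> \<open>This threshold gives \<open>t *\<^sub>R x\<close> a seminorm of at least
    \<open>K + q y\<close>, so that \<open>K\<close> remains after losing at most \<open>q y\<close>
    to the other summand.\<close>
  obtain x where x: "x \<in> C" "(K + q y) / t \<le> q x" using unbdd by blast
  let ?y = "(1 - t) *\<^sub>R y + t *\<^sub>R x"
  show ?thesis
  proof
    show "?y \<in> C" using C(2) t x(1) y by (simp add: convex_alt)
    have "K + q y \<le> q (t *\<^sub>R x)"
      using x(2) t by (simp add: scale field_simps)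
    also have "\<dots> = q (?y + - ((1 - t) *\<^sub>R y))" by simp
    also have "\<dots> \<le> q ?y + (1 - t) * q y"
      by (rule order_trans[OF triangle]) (use t in \<open>simp add: scale minus_eq\<close>)
    also have "(1 - t) * q y \<le> q y"
      using t nonneg[of y] by (simp add: mult_left_le_one_le)
    finally show "K \<le> q ?y" by simp
    have "\<bar>?y - y\<bar> = \<bar>t *\<^sub>R x - t *\<^sub>R y\<bar>" by (simp add: algebra_simps)
    also have "\<dots> \<le> t *\<^sub>R \<bar>x\<bar> + t *\<^sub>R \<bar>y\<bar>"
      using abs_triangle_ineq4[of "t *\<^sub>R x" "t *\<^sub>R y"] t by (simp add: abs_scaleR_nonneg)
    finally have "q (inf \<bar>?y - y\<bar> u) \<le> q (inf (t *\<^sub>R \<bar>x\<bar> + t *\<^sub>R \<bar>y\<bar>) u)"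
      using u by (intro truncated_mono) auto
    also have "\<dots> \<le> q (inf (t *\<^sub>R \<bar>x\<bar>) u) + q (inf (t *\<^sub>R \<bar>y\<bar>) u)"
      using t u by (intro truncated_add scaleR_nonneg_nonneg) auto
    also have "\<dots> \<le> e" using small[OF x(1)] small[OF y] by simp
    finally show "q (inf \<bar>?y - y\<bar> u) \<le> e" .
  qed
qed

lemma gliding_hump:
  assumes C: "komlos_set C" "convex C" and unbdd: "\<And>K. \<exists>x\<in>C. K \<le> q x"
  obtains y :: "nat \<Rightarrow> 'a" where "\<And>n. y n \<in> C" "\<And>n. real n \<le> q (y n)"
    "\<And>k n. k \<le> n \<Longrightarrow> q (inf \<bar>y (Suc n) - y n\<bar> \<bar>y k\<bar>) \<le> (1 / 2) ^ Suc n"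
proof -
  \<comment> \<open>A state pairs the current term with a running supremum that dominates the moduli
    of all terms so far, so one truncation level serves every \<open>k \<le> n\<close> at
    once.\<close>
  define P where "P n s \<longleftrightarrow> fst s \<in> C \<and> real n \<le> q (fst s) \<and> \<bar>fst s\<bar> \<le> snd s"
    for n :: nat and s :: "'a \<times> 'a"
  define Q where "Q n s s' \<longleftrightarrow> snd s \<le> snd s' \<and>
      q (inf \<bar>fst s' - fst s\<bar> (snd s)) \<le> (1 / 2) ^ Suc n" for n :: nat and s s' :: "'a \<times> 'a"
  have "\<exists>F. \<forall>n. P n (F n) \<and> Q n (F n) (F (Suc n))"
  proof (rule dependent_nat_choice)
    obtain x where "x \<in> C" using unbdd by blast
    then have "P 0 (x, \<bar>x\<bar>)" by (simp add: P_def nonneg)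
    then show "\<exists>s. P 0 s" ..
  next
    fix s n assume "P n s"
    then obtain y u where s: "s = (y, u)" "y \<in> C" "\<bar>y\<bar> \<le> u"
      unfolding P_def by (cases s) auto
    from s(3) have u: "0 \<le> u" using abs_ge_zero order_trans by blast
    obtain y' where "y' \<in> C" "real (Suc n) \<le> q y'" "q (inf \<bar>y' - y\<bar> u) \<le> (1 / 2) ^ Suc n"
      using gliding_hump_step[OF C unbdd s(2) u, of "(1 / 2) ^ Suc n" "real (Suc n)"] by auto
    then have "P (Suc n) (y', sup u \<bar>y'\<bar>) \<and> Q n s (y', sup u \<bar>y'\<bar>)"
      unfolding P_def Q_def s(1) by simp
    then show "\<exists>s'. P (Suc n) s' \<and> Q n s s'" ..
  qed
  then obtain F where F: "\<And>n. P n (F n)" "\<And>n. Q n (F n) (F (Suc n))" by blast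
  have snd_mono: "snd (F k) \<le> snd (F n)" if "k \<le> n" for k n
    using F(2) lift_Suc_mono_le[of "\<lambda>n. snd (F n)", OF _ that] unfolding Q_def by blast
  show ?thesis
  proof
    show "fst (F n) \<in> C" "real n \<le> q (fst (F n))" for n using F(1) unfolding P_def by auto
    fix k n :: nat assume "k \<le> n"
    then have "\<bar>fst (F k)\<bar> \<le> snd (F n)"
      using F(1) snd_mono unfolding P_def by (meson order_trans)
    then have "q (inf \<bar>fst (F (Suc n)) - fst (F n)\<bar> \<bar>fst (F k)\<bar>) \<le>
        q (inf \<bar>fst (F (Suc n)) - fst (F n)\<bar> (snd (F n)))"
      by (intro truncated_mono) auto
    also have "\<dots> \<le> (1 / 2) ^ Suc n" using F(2) unfolding Q_def by blast
    finally show "q (inf \<bar>fst (F (Suc n)) - fst (F n)\<bar> \<bar>fst (F k)\<bar>) \<le> (1 / 2) ^ Suc n" .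
  qed
qed

text \<open>For fixed \<open>k\<close>, the late Cesaro means stay, after truncation by
  \<open>\<bar>y k\<bar>\<close>, within 1 of \<open>y k\<close> up to a vanishing error. Hence so
  does \<open>v\<close>, which bounds \<open>q (y k)\<close> independently of
  \<open>k\<close>.\<close>

lemma komlos_set_bounded:
  assumes C: "komlos_set C" "convex C"
  shows "\<exists>K. \<forall>x\<in>C. q x \<le> K"
proof (rule ccontr)
  assume "\<not> ?thesis"
  then have "\<exists>x\<in>C. K \<le> q x" for K by (auto simp: not_le intro: less_imp_le)
  then obtain y :: "nat \<Rightarrow> 'a" where y: "\<And>n. y n \<in> C"
    and large: "\<And>n. real n \<le> q (y n)"
    and small: "\<And>k n. k \<le> n \<Longrightarrow> q (inf \<bar>y (Suc n) - y n\<bar> \<bar>y k\<bar>) \<le> (1 / 2) ^ Suc n"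
    using gliding_hump[OF C] by metis
  from C(1) y obtain r v where r: "strict_mono r" and conv: "uo_conv UNIV (\<le>) (cesaro (y \<circ> r)) v"
    by (rule komlos_setE)
  let ?c = "cesaro (y \<circ> r)"
  have bound: "real k \<le> q v + 1" for k
  proof -
    \<comment> \<open>\<open>W m\<close> is the variation of \<open>y\<close> from \<open>k\<close>
      to \<open>m\<close>. \<open>A\<close> absorbs the finitely many Cesaro terms whose index in
      \<open>y\<close> may lie below \<open>k\<close>; averaging makes its share vanish.\<close>
    define W where "W m = (\<Sum>j\<in>{k..<m}. \<bar>y (Suc j) - y j\<bar>)" for m
    define A where "A = (\<Sum>i<k. \<bar>y (r i) - y k\<bar>)"
    have A: "0 \<le> A" and W: "0 \<le> W m" for m unfolding A_def W_def by (auto intro: sum_nonneg)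
    \<comment> \<open>The constant 1 is the sum of the whole series of
      \<open>(1 / 2) ^ Suc j\<close>, hence uniform in \<open>m\<close>.\<close>
    have W_small: "q (inf (W m) \<bar>y k\<bar>) \<le> 1" for m
    proof -
      have "q (inf (W m) \<bar>y k\<bar>) \<le> (\<Sum>j\<in>{k..<m}. q (inf \<bar>y (Suc j) - y j\<bar> \<bar>y k\<bar>))"
        unfolding W_def by (intro truncated_sum) auto
      also have "\<dots> \<le> (\<Sum>j\<in>{k..<m}. (1 / 2) ^ Suc j)" by (intro sum_mono small) auto
      also have "\<dots> \<le> (\<Sum>j. (1 / 2 :: real) ^ Suc j)"
        by (intro sum_le_suminf sums_summable[OF power_half_series]) auto
      also have "\<dots> = 1" using power_half_series by (simp add: sums_iff)
      finally show ?thesis .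
    qed
    have W_tail: "\<bar>y i - y k\<bar> \<le> W m" if "k \<le> i" "i \<le> m" for i m
    proof -
      have "y i - y k = (\<Sum>j\<in>{k..<i}. y (Suc j) - y j)"
        using that by (simp add: sum_Suc_diff')
      also have "\<bar>\<dots>\<bar> \<le> W i" unfolding W_def by (rule abs_sum_le)
      also have "W i \<le> W m" unfolding W_def using that by (intro sum_mono2) auto
      finally show ?thesis .
    qed
    have c: "\<bar>?c n - y k\<bar> \<le> (1 / real (Suc n)) *\<^sub>R A + W (r n)" if "k \<le> n" for n
    proof -
      let ?t = "1 / real (Suc n)"
      \<comment> \<open>For \<open>i \<ge> k\<close> the index \<open>r i\<close> lies between
        \<open>k\<close> and \<open>r n\<close>, so \<open>W_tail\<close> applies; the terms with
        \<open>i < k\<close> are kept as they are.\<close>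
      have le: "\<bar>y (r i) - y k\<bar> \<le> (if i < k then \<bar>y (r i) - y k\<bar> else 0) + W (r n)" if "i \<le> n" for i
        using W[of "r n"] W_tail[of "r i" "r n"] that r seq_suble[OF r, of i]
        by (auto simp: strict_mono_less_eq)
      have "?c n - y k = ?t *\<^sub>R (\<Sum>i\<le>n. y (r i) - y k)"
        by (simp add: cesaro_def sum_subtractf scaleR_diff_right sum_constant_scaleR del: of_nat_Suc)
      then have "\<bar>?c n - y k\<bar> \<le> ?t *\<^sub>R (\<Sum>i\<le>n. \<bar>y (r i) - y k\<bar>)"
        by (simp add: abs_scaleR_nonneg scaleR_left_mono abs_sum_le)
      also have "\<dots> \<le> ?t *\<^sub>R (\<Sum>i\<le>n. (if i < k then \<bar>y (r i) - y k\<bar> else 0) + W (r n))"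
        by (intro scaleR_left_mono sum_mono le) auto
      also have "\<dots> = ?t *\<^sub>R A + W (r n)"
      proof -
        have "{i \<in> {..n}. i < k} = {..<k}" using that by auto
        then have "(\<Sum>i\<le>n. if i < k then \<bar>y (r i) - y k\<bar> else 0) = A"
          unfolding A_def by (simp add: sum.inter_filter[symmetric])
        then show ?thesis
          by (simp add: sum.distrib scaleR_add_right sum_constant_scaleR del: of_nat_Suc)
      qed
      finally show ?thesis .
    qed
    have le: "q (y k) \<le> (q v + 1) + (q (inf \<bar>?c n - v\<bar> \<bar>y k\<bar>) + (1 / real (Suc n)) * q A)"
      if n: "k \<le> n" for n
    proof -
      let ?tA = "(1 / real (Suc n)) *\<^sub>R A"
      have tA: "0 \<le> ?tA" using A by (intro scaleR_nonneg_nonneg) auto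
      have "\<bar>v - y k\<bar> \<le> \<bar>?c n - v\<bar> + \<bar>?c n - y k\<bar>"
        using abs_triangle_ineq4[of "?c n - y k" "?c n - v"] by (simp add: add.commute)
      also have "\<dots> \<le> \<bar>?c n - v\<bar> + (?tA + W (r n))" using c[OF n] by simp
      finally have "q (inf \<bar>v - y k\<bar> \<bar>y k\<bar>) \<le> q (inf (\<bar>?c n - v\<bar> + (?tA + W (r n))) \<bar>y k\<bar>)"
        by (intro truncated_mono) auto
      also have "\<dots> \<le> q (inf \<bar>?c n - v\<bar> \<bar>y k\<bar>) +
          (q (inf ?tA \<bar>y k\<bar>) + q (inf (W (r n)) \<bar>y k\<bar>))"
        using tA W
        by (intro order_trans[OF truncated_add] add_left_mono truncated_add add_nonneg_nonneg) auto
      also have "\<dots> \<le> q (inf \<bar>?c n - v\<bar> \<bar>y k\<bar>) + ((1 / real (Suc n)) * q A + 1)"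
        using W_small[of "r n"] truncated_le[OF tA, of "\<bar>y k\<bar>"]
        by (intro add_mono order_refl) (auto simp: scale)
      finally have "q (inf \<bar>v - y k\<bar> \<bar>y k\<bar>) \<le>
          q (inf \<bar>?c n - v\<bar> \<bar>y k\<bar>) + ((1 / real (Suc n)) * q A + 1)" .
      moreover have "q (y k) \<le> q v + q (inf \<bar>v - y k\<bar> \<bar>y k\<bar>)"
        using mono_nonneg[OF abs_ge_zero abs_le_add_inf_diff[of "y k" v]]
          triangle[of "\<bar>v\<bar>" "inf \<bar>v - y k\<bar> \<bar>y k\<bar>"] by simp
      ultimately show ?thesis by simp
    qed
    \<comment> \<open>Here \<open>k\<close> is fixed and \<open>n\<close> grows: the first error
      dies by uo-convergence, the second by averaging.\<close>
    have lim: "(\<lambda>n. (q v + 1) + (q (inf \<bar>?c n - v\<bar> \<bar>y k\<bar>) + (1 / real (Suc n)) * q A))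
        \<longlonglongrightarrow> (q v + 1) + (0 + 0)"
    proof (intro tendsto_add tendsto_const tendsto_mult_left_zero)
      show "(\<lambda>n. q (inf \<bar>?c n - v\<bar> \<bar>y k\<bar>)) \<longlonglongrightarrow> 0"
        using uo_conv_truncated[OF conv] by simp
      show "(\<lambda>n. 1 / real (Suc n)) \<longlonglongrightarrow> 0"
        using LIMSEQ_Suc[OF lim_1_over_n] by simp
    qed
    have "q (y k) \<le> (q v + 1) + (0 + 0)"
      by (rule Lim_bounded2[OF lim, where N = k]) (intro allI impI le)
    with large[of k] show ?thesis by simp
  qed
  obtain k :: nat where "q v + 1 < real k" using reals_Archimedean2 by blast
  with bound[of k] show False by simp
qed

end


section \<open>The modulus of an order continuous functional\<close>

text \<open>This is the value at \<open>\<bar>x\<bar>\<close> of the modulus of \<open>f\<close> in the order dual.\<close>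

definition modulus_seminorm :: "('a::banach_lattice \<Rightarrow>\<^sub>L real) \<Rightarrow> 'a \<Rightarrow> real" where
  "modulus_seminorm f x = (SUP y\<in>{y. \<bar>y\<bar> \<le> \<bar>x\<bar>}. blinfun_apply f y)"

text \<open>The supremum is finite because monotonicity of the norm makes order intervals norm
  bounded.\<close>

lemma modulus_seminorm_upper:
  assumes "\<bar>y\<bar> \<le> \<bar>x\<bar>"
  shows "blinfun_apply f y \<le> modulus_seminorm f x"
  unfolding modulus_seminorm_def
proof (rule cSUP_upper)
  show "bdd_above (blinfun_apply f ` {y. \<bar>y\<bar> \<le> \<bar>x\<bar>})"
  proof (rule bdd_aboveI2)
    fix y assume "y \<in> {y. \<bar>y\<bar> \<le> \<bar>x\<bar>}"
    then have "norm y \<le> norm x" by (simp add: norm_mono_abs)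
    then have "norm f * norm y \<le> norm f * norm x" by (simp add: mult_left_mono)
    with norm_blinfun[of f y] show "blinfun_apply f y \<le> norm f * norm x" by simp
  qed
qed (use assms in simp)

lemma modulus_seminorm_least:
  assumes "\<And>y. \<bar>y\<bar> \<le> \<bar>x\<bar> \<Longrightarrow> blinfun_apply f y \<le> K"
  shows "modulus_seminorm f x \<le> K"
  unfolding modulus_seminorm_def using assms by (intro cSUP_least) auto

lemma abs_apply_le_modulus_seminorm: "\<bar>blinfun_apply f x\<bar> \<le> modulus_seminorm f x"
  using modulus_seminorm_upper[of x x f] modulus_seminorm_upper[of "- x" x f]
  by (simp add: blinfun.minus_right)

lemma modulus_seminorm_mono:
  "\<bar>x\<bar> \<le> \<bar>y\<bar> \<Longrightarrow> modulus_seminorm f x \<le> modulus_seminorm f y"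
  by (intro modulus_seminorm_least modulus_seminorm_upper) (rule order_trans)

text \<open>Riesz decomposition splits each competitor for \<open>x + y\<close> into competitors for
  \<open>x\<close> and \<open>y\<close>.\<close>

lemma modulus_seminorm_triangle:
  "modulus_seminorm f (x + y) \<le> modulus_seminorm f x + modulus_seminorm f y"
proof (rule modulus_seminorm_least)
  fix z assume "\<bar>z\<bar> \<le> \<bar>x + y\<bar>"
  then have "\<bar>z\<bar> \<le> \<bar>x\<bar> + \<bar>y\<bar>" using abs_triangle_ineq order_trans by blast
  then obtain z1 z2 where "z = z1 + z2" "\<bar>z1\<bar> \<le> \<bar>x\<bar>" "\<bar>z2\<bar> \<le> \<bar>y\<bar>"
    by (rule abs_le_add_decompose) auto
  then show "blinfun_apply f z \<le> modulus_seminorm f x + modulus_seminorm f y"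
    by (simp add: blinfun.add_right add_mono modulus_seminorm_upper)
qed

text \<open>Competitors for \<open>u\<close> and \<open>v\<close> add up to a competitor for
  \<open>u + v\<close>, because moduli are additive on the positive cone. The two suprema are then
  taken one after the other.\<close>

lemma modulus_seminorm_superadditive:
  assumes "0 \<le> u" "0 \<le> v"
  shows "modulus_seminorm f u + modulus_seminorm f v \<le> modulus_seminorm f (u + v)"
proof -
  have *: "blinfun_apply f y + blinfun_apply f z \<le> modulus_seminorm f (u + v)"
    if "\<bar>y\<bar> \<le> \<bar>u\<bar>" "\<bar>z\<bar> \<le> \<bar>v\<bar>" for y z
  proof -
    have "\<bar>y + z\<bar> \<le> \<bar>u + v\<bar>"
      using abs_triangle_ineq[of y z] add_mono[OF that] assms by simp
    from modulus_seminorm_upper[OF this, of f] show ?thesis by (simp add: blinfun.add_right)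
  qed
  have "modulus_seminorm f v \<le> modulus_seminorm f (u + v) - modulus_seminorm f u"
  proof (rule modulus_seminorm_least)
    fix z assume z: "\<bar>z\<bar> \<le> \<bar>v\<bar>"
    have "modulus_seminorm f u \<le> modulus_seminorm f (u + v) - blinfun_apply f z"
      using *[OF _ z] by (intro modulus_seminorm_least) (simp add: algebra_simps)
    then show "blinfun_apply f z \<le> modulus_seminorm f (u + v) - modulus_seminorm f u" by simp
  qed
  then show ?thesis by simp
qed

lemma modulus_seminorm_scale:
  assumes "0 \<le> c"
  shows "modulus_seminorm f (c *\<^sub>R x) = c * modulus_seminorm f x"
proof -
  have le: "modulus_seminorm f (c *\<^sub>R x) \<le> c * modulus_seminorm f x" if c: "0 < c" for c x
  proof (rule modulus_seminorm_least)
    fix y assume "\<bar>y\<bar> \<le> \<bar>c *\<^sub>R x\<bar>"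
    then have "inverse c *\<^sub>R \<bar>y\<bar> \<le> inverse c *\<^sub>R (c *\<^sub>R \<bar>x\<bar>)"
      using c by (intro scaleR_left_mono) (simp_all add: abs_scaleR_nonneg)
    then have "\<bar>inverse c *\<^sub>R y\<bar> \<le> \<bar>x\<bar>" using c by (simp add: abs_scaleR_nonneg)
    from modulus_seminorm_upper[OF this, of f] c
    show "blinfun_apply f y \<le> c * modulus_seminorm f x"
      by (simp add: blinfun.scaleR_right field_simps)
  qed
  show ?thesis
  proof (cases "c = 0")
    case True
    have "modulus_seminorm f 0 \<le> 0" by (rule modulus_seminorm_least) simp
    with True abs_apply_le_modulus_seminorm[of f 0] show ?thesis by simp
  next
    case False
    with assms have c: "0 < c" by simp
    have "modulus_seminorm f x \<le> inverse c * modulus_seminorm f (c *\<^sub>R x)"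
      using le[of "inverse c" "c *\<^sub>R x"] c by simp
    with le[OF c, of x] c show ?thesis by (simp add: field_simps)
  qed
qed

text \<open>Superadditivity on the positive cone reduces smallness of \<open>modulus_seminorm f (a j)\<close> to a
  nearly optimal \<open>y\<close> for a fixed \<open>a j0\<close>: the part of \<open>y\<close> below \<open>a j\<close> is order null.\<close>

lemma modulus_seminorm_decreasing_net:
  assumes f: "f \<in> oc_dual" and a: "decreases_to J leJ a 0" and e: "0 < e"
  shows "\<exists>j\<in>J. modulus_seminorm f (a j) < e"
proof -
  have dir: "directed_by J leJ"
    and mono: "\<And>i j. i \<in> J \<Longrightarrow> j \<in> J \<Longrightarrow> leJ i j \<Longrightarrow> a j \<le> a i"
    and glb: "isGlb UNIV (a ` J) 0"
    using a by (auto simp: decreases_to_def)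
  have nonneg: "0 \<le> a j" if "j \<in> J" for j
    using isGlbD2[OF glb] that by blast
  from dir obtain j0 where j0: "j0 \<in> J" unfolding directed_by_def by blast
  obtain y where y: "\<bar>y\<bar> \<le> a j0" "modulus_seminorm f (a j0) - e / 2 < blinfun_apply f y"
  proof (rule ccontr)
    assume "\<not> thesis"
    then have "modulus_seminorm f (a j0) \<le> modulus_seminorm f (a j0) - e / 2"
      using that nonneg[OF j0] by (intro modulus_seminorm_least) (auto simp: not_less[symmetric])
    with e show False by simp
  qed
  \<comment> \<open>\<open>z\<close> is the part of \<open>y\<close> below \<open>a j\<close>, by
    Riesz decomposition. The default 0 for indices not above \<open>j0\<close> keeps the whole net
    dominated by \<open>a\<close>.\<close>
  have "\<exists>z. \<bar>z\<bar> \<le> a j \<and> (leJ j0 j \<longrightarrow> \<bar>y - z\<bar> \<le> a j0 - a j)" if j: "j \<in> J" for j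
  proof (cases "leJ j0 j")
    case True
    obtain y1 y2 where "y = y1 + y2" "\<bar>y1\<bar> \<le> a j" "\<bar>y2\<bar> \<le> a j0 - a j"
      by (rule abs_le_add_decompose[of y "a j" "a j0 - a j"])
        (use y(1) nonneg[OF j] mono[OF j0 j True] in auto)
    then show ?thesis by (intro exI[of _ y1]) simp
  next
    case False
    then show ?thesis using nonneg[OF j] by (intro exI[of _ 0]) simp
  qed
  then obtain z where z: "\<And>j. j \<in> J \<Longrightarrow> \<bar>z j\<bar> \<le> a j"
    "\<And>j. j \<in> J \<Longrightarrow> leJ j0 j \<Longrightarrow> \<bar>y - z j\<bar> \<le> a j0 - a j" by metis
  have "order_conv J leJ z 0"
  proof (rule order_convI[OF a], intro ballI)
    fix j assume j: "j \<in> J"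
    have "\<bar>z i - 0\<bar> \<le> a j" if "i \<in> J" "leJ j i" for i
      using order_trans[OF z(1) mono] that j by simp
    with j show "\<exists>i0\<in>J. \<forall>i\<in>J. leJ i0 i \<longrightarrow> \<bar>z i - 0\<bar> \<le> a j" by blast
  qed
  from oc_dualD[OF f dir this, of "e / 2"] e obtain i0 where i0: "i0 \<in> J"
    "\<And>i. i \<in> J \<Longrightarrow> leJ i0 i \<Longrightarrow> \<bar>blinfun_apply f (z i)\<bar> < e / 2" by auto
  from dir i0(1) j0 obtain j where j: "j \<in> J" "leJ i0 j" "leJ j0 j"
    unfolding directed_by_def by blast
  have pos: "0 \<le> a j0 - a j" using mono[OF j0 j(1,3)] by simp
  \<comment> \<open>The value at \<open>a j0\<close> will cancel: \<open>f\<close> at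
    \<open>y\<close> is within \<open>e / 2\<close> of it, and superadditivity bounds
    \<open>f\<close> at \<open>y - z j\<close> by the same value minus that at
    \<open>a j\<close>.\<close>
  have "blinfun_apply f y = blinfun_apply f (z j) + blinfun_apply f (y - z j)"
    by (simp add: blinfun.diff_right)
  also have "blinfun_apply f (y - z j) \<le> modulus_seminorm f (a j0 - a j)"
    using z(2)[OF j(1,3)] pos by (intro modulus_seminorm_upper) simp
  also have "\<dots> \<le> modulus_seminorm f (a j0) - modulus_seminorm f (a j)"
    using modulus_seminorm_superadditive[OF nonneg[OF j(1)] pos, of f] by simp
  finally have "modulus_seminorm f (a j) < e"
    using y(2) i0(2)[OF j(1,2)] by simp
  with j(1) show ?thesis by blast
qed

text \<open>By monotonicity, one dominating element with small seminorm controls a whole tail of the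
  sequence.\<close>

lemma order_continuous_seminorm_modulus:
  assumes f: "f \<in> oc_dual"
  shows "order_continuous_seminorm (modulus_seminorm f)"
proof
  fix X :: "nat \<Rightarrow> 'a"
  assume "order_conv UNIV (\<le>) X 0"
  then obtain J :: "'a set" and leJ a where a: "decreases_to J leJ a 0"
    and dom: "\<And>j. j \<in> J \<Longrightarrow> \<exists>n0. \<forall>n\<ge>n0. \<bar>X n\<bar> \<le> a j"
    unfolding order_conv_def by auto
  show "(\<lambda>n. modulus_seminorm f (X n)) \<longlonglongrightarrow> 0"
  proof (rule LIMSEQ_I)
    fix e :: real assume "0 < e"
    from modulus_seminorm_decreasing_net[OF f a this] obtain j
      where j: "j \<in> J" "modulus_seminorm f (a j) < e" by blast
    from dom[OF j(1)] obtain n0 where n0: "\<And>n. n \<ge> n0 \<Longrightarrow> \<bar>X n\<bar> \<le> a j" by blast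
    have "norm (modulus_seminorm f (X n) - 0) < e" if "n \<ge> n0" for n
    proof -
      have "\<bar>X n\<bar> \<le> \<bar>a j\<bar>" using n0[OF that] abs_ge_self order_trans by blast
      from modulus_seminorm_mono[OF this, of f] j(2) abs_apply_le_modulus_seminorm[of f "X n"]
      show ?thesis by simp
    qed
    then show "\<exists>n0. \<forall>n\<ge>n0. norm (modulus_seminorm f (X n) - 0) < e" by blast
  qed
qed (auto intro: modulus_seminorm_mono modulus_seminorm_triangle modulus_seminorm_scale)


section \<open>Uniform boundedness over the order continuous dual\<close>

text \<open>An order null net is eventually order bounded, hence eventually norm bounded, so a
  functional close in norm is uniformly close on a tail.\<close>

lemma closed_oc_dual: "closed (oc_dual :: ('a::banach_lattice \<Rightarrow>\<^sub>L real) set)"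
proof -
  have "f \<in> oc_dual" if f: "f \<in> closure oc_dual" for f :: "'a \<Rightarrow>\<^sub>L real"
    unfolding oc_dual_def order_continuous_def net_tendsto_real_def mem_Collect_eq
  proof (intro allI impI)
    fix I :: "('a \<times> 'a set) set" and le and x :: "'a \<times> 'a set \<Rightarrow> 'a" and e :: real
    assume dir: "directed_by I le" and conv: "order_conv I le x 0" and e: "0 < e"
    from conv obtain J :: "'a set" and leJ a where a: "decreases_to J leJ a 0"
      and dom: "\<And>j. j \<in> J \<Longrightarrow> \<exists>i0\<in>I. \<forall>i\<in>I. le i0 i \<longrightarrow> \<bar>x i - 0\<bar> \<le> a j"
      unfolding order_conv_def by blast
    from a obtain j where "j \<in> J" unfolding decreases_to_def directed_by_def by blast
    from dom[OF this] obtain i1 where i1: "i1 \<in> I"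
      "\<And>i. i \<in> I \<Longrightarrow> le i1 i \<Longrightarrow> \<bar>x i\<bar> \<le> a j" by auto
    \<comment> \<open>Adding 1 keeps the divisor positive when \<open>a j\<close> is 0.\<close>
    let ?B = "norm (a j) + 1"
    have B: "0 < ?B" by (simp add: add_nonneg_pos)
    obtain g where g: "g \<in> oc_dual" "norm (f - g) < e / 2 / ?B"
      using f e B unfolding closure_approachable
      by (metis dist_commute dist_norm divide_pos_pos half_gt_zero)
    from oc_dualD[OF g(1) dir conv, of "e / 2"] e obtain i2 where i2: "i2 \<in> I"
      "\<And>i. i \<in> I \<Longrightarrow> le i2 i \<Longrightarrow> \<bar>blinfun_apply g (x i)\<bar> < e / 2" by auto
    from dir i1(1) i2(1) obtain k where k: "k \<in> I" "le i1 k" "le i2 k"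
      unfolding directed_by_def by blast
    have "\<bar>blinfun_apply f (x i) - 0\<bar> < e" if i: "i \<in> I" "le k i" for i
    proof -
      have le: "le i1 i" "le i2 i" using dir i1(1) i2(1) k i unfolding directed_by_def by blast+
      have "\<bar>x i\<bar> \<le> \<bar>a j\<bar>" using i1(2)[OF i(1) le(1)] abs_ge_self order_trans by blast
      then have "norm (x i) \<le> ?B" using norm_mono_abs[of "x i" "a j"] by simp
      then have "norm (f - g) * norm (x i) \<le> e / 2 / ?B * ?B"
        using g(2) B e by (intro mult_mono) auto
      also have "\<dots> = e / 2" using B by (intro nonzero_eq_divide_eq[THEN iffD1, OF _ refl]) simp
      finally have "\<bar>blinfun_apply f (x i) - blinfun_apply g (x i)\<bar> \<le> e / 2"
        using norm_blinfun[of "f - g" "x i"] by (simp add: blinfun.diff_left)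
      with i2(2)[OF i(1) le(2)] show ?thesis by linarith
    qed
    with k(1) show "\<exists>i0\<in>I. \<forall>i\<in>I. le i0 i \<longrightarrow> \<bar>blinfun_apply f (x i) - 0\<bar> < e" by blast
  qed
  then show ?thesis by (simp add: subsetI flip: closure_subset_eq)
qed

text \<open>The Baire category theorem is applied inside \<open>F\<close>, which is complete as a
  closed subset of the dual Banach space; the points of \<open>C\<close> act as functionals on
  \<open>F\<close>.\<close>

lemma uniform_boundedness_closed_subspace:
  fixes F :: "('a::real_normed_vector \<Rightarrow>\<^sub>L real) set"
  assumes "closed F" and F: "subspace F"
    and pointwise: "\<And>f. f \<in> F \<Longrightarrow> \<exists>K. \<forall>x\<in>C. \<bar>blinfun_apply f x\<bar> \<le> K"
  obtains K where "\<And>f x. f \<in> F \<Longrightarrow> norm f \<le> 1 \<Longrightarrow> x \<in> C \<Longrightarrow> \<bar>blinfun_apply f x\<bar> \<le> K"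
proof -
  define A where "A n = {f \<in> F. \<forall>x\<in>C. \<bar>blinfun_apply f x\<bar> \<le> real n}" for n :: nat
  let ?X = "top_of_set F"
  have closed: "closedin ?X (A n)" for n
  proof -
    have "A n = F \<inter> (\<Inter>x\<in>C. {f. \<bar>blinfun_apply f x\<bar> \<le> real n})" unfolding A_def by auto
    moreover have "closed (\<Inter>x\<in>C. {f. \<bar>blinfun_apply f x\<bar> \<le> real n})"
      by (intro closed_INT ballI closed_Collect_le continuous_intros)
    ultimately show ?thesis by (simp add: closedin_closed_Int)
  qed
  have "\<Union>(range A) = F"
  proof (intro equalityI subsetI)
    fix f assume f: "f \<in> F"
    from pointwise[OF f] obtain K where K: "\<forall>x\<in>C. \<bar>blinfun_apply f x\<bar> \<le> K" by blast
    obtain n :: nat where "K \<le> real n" using real_arch_simple by blast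
    with K f have "f \<in> A n" unfolding A_def by force
    then show "f \<in> \<Union>(range A)" by blast
  qed (auto simp: A_def)
  moreover have "?X interior_of F = F"
    using interior_of_topspace[of ?X] by simp
  moreover have "F \<noteq> {}" using F subspace_0 by blast
  moreover have "completely_metrizable_space ?X"
    using \<open>closed F\<close>
    by (intro completely_metrizable_space_closedin completely_metrizable_space_euclidean)
      (simp only: closed_closedin)
  \<comment> \<open>If every \<open>A n\<close> had empty interior relative to \<open>F\<close>, so
    would their union \<open>F\<close>, but \<open>F\<close> is nonempty and its own relative
    interior.\<close>
  ultimately obtain n where "?X interior_of A n \<noteq> {}"
    using Baire_category_alt[of ?X "range A"] closed by auto
  then obtain f0 where f0: "f0 \<in> ?X interior_of A n" by blast
  moreover have "openin ?X (?X interior_of A n)" by simp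
  ultimately obtain e where e: "0 < e" "ball f0 e \<inter> F \<subseteq> ?X interior_of A n"
    unfolding openin_contains_ball by blast
  have ball: "ball f0 e \<inter> F \<subseteq> A n" using order_trans[OF e(2) interior_of_subset] .
  have f0A: "f0 \<in> A n" using subsetD[OF interior_of_subset f0] .
  show ?thesis
  proof (rule that)
    fix f x assume f: "f \<in> F" "norm f \<le> 1" and x: "x \<in> C"
    \<comment> \<open>The factor \<open>e / 2\<close> keeps \<open>?g\<close> inside the open ball.
      Subtracting \<open>f0\<close> costs another \<open>n\<close>, whence the bound
      \<open>4 * real n / e\<close>.\<close>
    let ?g = "f0 + (e / 2) *\<^sub>R f"
    have "norm ((e / 2) *\<^sub>R f) < e"
      using e(1) mult_left_mono[OF f(2), of "e / 2"] by simp
    then have "?g \<in> ball f0 e" by (simp add: dist_norm)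
    moreover have "?g \<in> F"
      using f0A f(1) F by (simp add: A_def subspace_add subspace_scale)
    ultimately have "\<bar>blinfun_apply ?g x\<bar> \<le> real n" "\<bar>blinfun_apply f0 x\<bar> \<le> real n"
      using ball f0A x unfolding A_def by blast+
    then have "\<bar>e / 2 * blinfun_apply f x\<bar> \<le> 2 * real n"
      by (simp add: blinfun.add_left blinfun.scaleR_left)
    then show "\<bar>blinfun_apply f x\<bar> \<le> 4 * real n / e"
      using e(1) by (simp add: abs_mult field_simps)
  qed
qed

section \<open>From pointwise bounds on the order continuous dual to norm boundedness\<close>

theorem theorem5p23:
  fixes C :: "'a::banach_lattice set"
  assumes "projection_property TYPE('a)"
    and "norming (oc_dual :: ('a \<Rightarrow>\<^sub>L real) set)"
    and "convex C"
    and "komlos_set C"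
  shows "bounded C"
proof -
  let ?F = "oc_dual :: ('a \<Rightarrow>\<^sub>L real) set"
  let ?p = "\<lambda>x. SUP f\<in>{f\<in>?F. norm f \<le> 1}. \<bar>blinfun_apply f x\<bar>"
  have "\<exists>K. \<forall>x\<in>C. \<bar>blinfun_apply f x\<bar> \<le> K" if f: "f \<in> ?F" for f
    using order_continuous_seminorm.komlos_set_bounded
      [OF order_continuous_seminorm_modulus[OF f] assms(4,3)]
      abs_apply_le_modulus_seminorm[of f] by (meson order_trans)
  with closed_oc_dual subspace_oc_dual obtain K
    where K: "\<And>f x. f \<in> ?F \<Longrightarrow> norm f \<le> 1 \<Longrightarrow> x \<in> C \<Longrightarrow> \<bar>blinfun_apply f x\<bar> \<le> K"
    by (rule uniform_boundedness_closed_subspace) blast+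
  have "equivalent_norms ?p norm"
    using assms(2) unfolding norming_def Let_def by blast
  then obtain c where c: "0 < c" "\<And>x. c * norm x \<le> ?p x"
    unfolding equivalent_norms_def by blast
  have "norm x \<le> K / c" if x: "x \<in> C" for x
  proof -
    \<comment> \<open>The unit ball of the order continuous dual contains 0, so the supremum is over
      a nonempty set.\<close>
    have "?p x \<le> K"
    proof (rule cSUP_least)
      show "{f\<in>?F. norm f \<le> 1} \<noteq> {}"
        using subspace_0[OF subspace_oc_dual] by force
    qed (use K x in blast)
    with c(2)[of x] have "c * norm x \<le> K" by simp
    with c(1) show ?thesis by (simp add: field_simps)
  qed
  then show ?thesis unfolding bounded_iff by blast
qed

end
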